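(* Let $(\Omega,\mathcal{F},P)$ be a nonatomic probability space (namely $\mathcal{F}$ does not include any $P$-atoms), let $(E,\mathcal{P})=(L^0(\mathcal{F},\mathbb{R}),|\cdot|)$, and let $M=\{x\in E:\text{there exists a positive number }m_x\text{ such that }x>m_x\text{ on }\Omega\}$. Then $\tilde I_A\{0\}\cap\tilde I_AM=\emptyset$ for all $A\in\mathcal{F}$ with $P(A)>0$. But for any $L^0$-convex, $L^0$-absorbent and $L^0$-balanced $\mathcal{T}_c$-neighborhood $U$ of $0$ there is always $A_U\in\mathcal{F}$ with $P(A_U)>0$ such that $\tilde I_{A_U}U\cap\tilde I_{A_U}(M+U)\neq\emptyset$.
   Context: $L^0(\mathcal{F},\mathbb{R})=L^0(\mathcal{F})$ is the algebra of equivalence classes (a.s. equality) of real-valued $\mathcal{F}$-measurable random variables, ordered by a.s. $\le$. "$x>m$ on $\Omega$" means $x(\omega)>m$ for $P$-almost all $\omega\in\Omega$. $L^0_+(\mathcal{F})=\{\xi\in L^0(\mathcal{F}):\xi\ge0\}$, $L^0_{++}(\mathcal{F})=\{\xi\in L^0(\mathcal{F}):\xi>0\text{ on }\Omega\}$. $\tilde I_A$ is the class of the indicator of $A\in\mathcal{F}$ and $\tilde I_AG=\{\tilde I_Ag:g\in G\}$. $\mathcal{T}_c$ is the topology on $L^0(\mathcal{F})$ in which a set $G$ is open iff for each $x\in G$ there is $\varepsilon\in L^0_{++}(\mathcal{F})$ with $\{y\in L^0(\mathcal{F}):|y-x|\le\varepsilon\}\subset G$. A subset $B\subset E$ is: $L^0$-convex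 if $\xi x+(1-\xi)y\in B$ for all $x,y\in B$, $\xi\in L^0_+(\mathcal{F})$, $0\le\xi\le1$; $L^0$-balanced if $\eta B\subset B$ for all $\eta\in L^0(\mathcal{F})$ with $|\eta|\le1$; $L^0$-absorbent if for each $x\in E$ there is $\xi\in L^0_{++}(\mathcal{F})$ with $\eta x\in B$ for all $\eta\in L^0(\mathcal{F})$ with $|\eta|\le\xi$. *)

theory Defs
  imports
    "HOL-Probability.Probability"
    "HOL-Algebra.AbelCoset"
begin

definition ae_rel :: "'a measure \<Rightarrow> (('a \<Rightarrow> real) \<times> ('a \<Rightarrow> real)) set" where
  "ae_rel P = {(f, g). f \<in> borel_measurable P \<and> g \<in> borel_measurable P \<and>
                       (AE \<omega> in P. f \<omega> = g \<omega>)}"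

definition L0_class :: "'a measure \<Rightarrow> ('a \<Rightarrow> real) \<Rightarrow> ('a \<Rightarrow> real) set" where
  "L0_class P f = ae_rel P `` {f}"

definition L0_lift2 ::
  "'a measure \<Rightarrow> (real \<Rightarrow> real \<Rightarrow> real) \<Rightarrow> ('a \<Rightarrow> real) set \<Rightarrow> ('a \<Rightarrow> real) set \<Rightarrow> ('a \<Rightarrow> real) set"
where
  "L0_lift2 P op X Y = (\<Union>f\<in>X. \<Union>g\<in>Y. L0_class P (\<lambda>\<omega>. op (f \<omega>) (g \<omega>)))"

definition L0 :: "'a measure \<Rightarrow> ('a \<Rightarrow> real) set ring" where
  "L0 P = \<lparr>carrier = borel_measurable P // ae_rel P,
           mult = L0_lift2 P (*),
           one = L0_class P (\<lambda>_. 1),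
           zero = L0_class P (\<lambda>_. 0),
           add = L0_lift2 P (+)\<rparr>"

definition L0_const :: "'a measure \<Rightarrow> real \<Rightarrow> ('a \<Rightarrow> real) set" where
  "L0_const P c = L0_class P (\<lambda>_. c)"

definition L0_ind :: "'a measure \<Rightarrow> 'a set \<Rightarrow> ('a \<Rightarrow> real) set" where
  "L0_ind P A = L0_class P (indicator A)"

definition L0_abs :: "'a measure \<Rightarrow> ('a \<Rightarrow> real) set \<Rightarrow> ('a \<Rightarrow> real) set" where
  "L0_abs P X = (\<Union>f\<in>X. L0_class P (\<lambda>\<omega>. \<bar>f \<omega>\<bar>))"

definition L0_le :: "'a measure \<Rightarrow> ('a \<Rightarrow> real) set \<Rightarrow> ('a \<Rightarrow> real) set \<Rightarrow> bool" where
  "L0_le P X Y \<longleftrightarrow> (\<forall>f\<in>X. \<forall>g\<in>Y. AE \<omega> in P. f \<omega> \<le> g \<omega>)"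

text \<open>Strict inequality almost everywhere on the whole space (``\<open>X < Y\<close> on \<open>\<Omega>\<close>''), which is
  stronger than \<open>X \<le> Y\<close> together with \<open>X \<noteq> Y\<close>.\<close>

definition L0_less_on :: "'a measure \<Rightarrow> ('a \<Rightarrow> real) set \<Rightarrow> ('a \<Rightarrow> real) set \<Rightarrow> bool" where
  "L0_less_on P X Y \<longleftrightarrow> (\<forall>f\<in>X. \<forall>g\<in>Y. AE \<omega> in P. f \<omega> < g \<omega>)"

definition L0_plus :: "'a measure \<Rightarrow> ('a \<Rightarrow> real) set set" where
  "L0_plus P = {\<xi> \<in> carrier (L0 P). L0_le P \<zero>\<^bsub>L0 P\<^esub> \<xi>}"

definition L0_pplus :: "'a measure \<Rightarrow> ('a \<Rightarrow> real) set set" where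
  "L0_pplus P = {\<xi> \<in> carrier (L0 P). L0_less_on P \<zero>\<^bsub>L0 P\<^esub> \<xi>}"

definition L0_topology :: "'a measure \<Rightarrow> ('a \<Rightarrow> real) set topology" where
  "L0_topology P = topology (\<lambda>G. G \<subseteq> carrier (L0 P) \<and>
     (\<forall>x\<in>G. \<exists>\<epsilon>\<in>L0_pplus P.
        {y \<in> carrier (L0 P). L0_le P (L0_abs P (y \<ominus>\<^bsub>L0 P\<^esub> x)) \<epsilon>} \<subseteq> G))"

definition nbhd_of :: "'b topology \<Rightarrow> 'b \<Rightarrow> 'b set \<Rightarrow> bool" where
  "nbhd_of T x U \<longleftrightarrow> U \<subseteq> topspace T \<and> (\<exists>V. openin T V \<and> x \<in> V \<and> V \<subseteq> U)"

text \<open>The next three notions are meant for subsets \<open>B\<close> of the module \<open>L0 P\<close> over itself.\<close>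

definition L0_convex :: "'a measure \<Rightarrow> ('a \<Rightarrow> real) set set \<Rightarrow> bool" where
  "L0_convex P B \<longleftrightarrow>
     (\<forall>x\<in>B. \<forall>y\<in>B. \<forall>\<xi>\<in>L0_plus P. L0_le P \<xi> \<one>\<^bsub>L0 P\<^esub> \<longrightarrow>
        \<xi> \<otimes>\<^bsub>L0 P\<^esub> x \<oplus>\<^bsub>L0 P\<^esub> (\<one>\<^bsub>L0 P\<^esub> \<ominus>\<^bsub>L0 P\<^esub> \<xi>) \<otimes>\<^bsub>L0 P\<^esub> y \<in> B)"

definition L0_balanced :: "'a measure \<Rightarrow> ('a \<Rightarrow> real) set set \<Rightarrow> bool" where
  "L0_balanced P B \<longleftrightarrow>
     (\<forall>\<eta>\<in>carrier (L0 P). L0_le P (L0_abs P \<eta>) \<one>\<^bsub>L0 P\<^esub> \<longrightarrow> \<eta> <#\<^bsub>L0 P\<^esub> B \<subseteq> B)"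

definition L0_absorbent :: "'a measure \<Rightarrow> ('a \<Rightarrow> real) set set \<Rightarrow> bool" where
  "L0_absorbent P B \<longleftrightarrow>
     (\<forall>x\<in>carrier (L0 P). \<exists>\<xi>\<in>L0_pplus P. \<forall>\<eta>\<in>carrier (L0 P).
        L0_le P (L0_abs P \<eta>) \<xi> \<longrightarrow> \<eta> \<otimes>\<^bsub>L0 P\<^esub> x \<in> B)"

definition is_atom :: "'a measure \<Rightarrow> 'a set \<Rightarrow> bool" where
  "is_atom P A \<longleftrightarrow> A \<in> sets P \<and> 0 < measure P A \<and>
     (\<forall>B\<in>sets P. B \<subseteq> A \<longrightarrow> measure P B = 0 \<or> measure P B = measure P A)"

definition nonatomic :: "'a measure \<Rightarrow> bool" where
  "nonatomic P \<longleftrightarrow> (\<nexists>A. is_atom P A)"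


text \<open>The operations and relations above act on representatives, \<open>L0 P\<close> is a commutative ring
  (so that \<open>\<ominus>\<close> is meaningful) and the family of sets in \<open>L0_topology\<close> is a topology.\<close>

lemma equiv_ae_rel: "equiv (borel_measurable P) (ae_rel P)"
proof (rule equivI)
  show "trans (ae_rel P)"
  proof (rule transI)
    fix f g h assume fg: "(f, g) \<in> ae_rel P" and gh: "(g, h) \<in> ae_rel P"
    then have "AE \<omega> in P. f \<omega> = g \<omega>" "AE \<omega> in P. g \<omega> = h \<omega>"
      by (auto simp: ae_rel_def)
    then have "AE \<omega> in P. f \<omega> = h \<omega>"
      by eventually_elim simp
    then show "(f, h) \<in> ae_rel P"
      using fg gh by (auto simp: ae_rel_def)
  qed
qed (auto simp: ae_rel_def refl_on_def sym_def eq_commute)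

lemma mem_L0_class:
  "f \<in> borel_measurable P \<Longrightarrow>
    g \<in> L0_class P f \<longleftrightarrow> g \<in> borel_measurable P \<and> (AE \<omega> in P. f \<omega> = g \<omega>)"
  by (auto simp: L0_class_def ae_rel_def)

lemma L0_class_refl: "f \<in> borel_measurable P \<Longrightarrow> f \<in> L0_class P f"
  by (simp add: mem_L0_class)

lemma L0_class_eq_iff:
  "f \<in> borel_measurable P \<Longrightarrow> g \<in> borel_measurable P \<Longrightarrow>
    L0_class P f = L0_class P g \<longleftrightarrow> (AE \<omega> in P. f \<omega> = g \<omega>)"
  unfolding L0_class_def
  by (subst eq_equiv_class_iff[OF equiv_ae_rel]) (auto simp: ae_rel_def)

lemma L0_class_in_carrier: "f \<in> borel_measurable P \<Longrightarrow> L0_class P f \<in> carrier (L0 P)"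
  by (auto simp: L0_def L0_class_def intro: quotientI)

lemma L0_carrierE:
  assumes "X \<in> carrier (L0 P)"
  obtains f where "f \<in> borel_measurable P" "X = L0_class P f"
  using assms by (auto simp: L0_def L0_class_def elim: quotientE)

lemma L0_lift2_class:
  assumes f: "f \<in> borel_measurable P" and g: "g \<in> borel_measurable P"
    and op: "\<And>u v. u \<in> borel_measurable P \<Longrightarrow> v \<in> borel_measurable P \<Longrightarrow>
               (\<lambda>\<omega>. op (u \<omega>) (v \<omega>)) \<in> borel_measurable P"
  shows "L0_lift2 P op (L0_class P f) (L0_class P g) = L0_class P (\<lambda>\<omega>. op (f \<omega>) (g \<omega>))"
proof -
  have "L0_class P (\<lambda>\<omega>. op (u \<omega>) (v \<omega>)) = L0_class P (\<lambda>\<omega>. op (f \<omega>) (g \<omega>))"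
    if "u \<in> L0_class P f" "v \<in> L0_class P g" for u v
  proof -
    have u: "u \<in> borel_measurable P" "AE \<omega> in P. f \<omega> = u \<omega>"
      and v: "v \<in> borel_measurable P" "AE \<omega> in P. g \<omega> = v \<omega>"
      using that f g by (auto simp: mem_L0_class)
    have "AE \<omega> in P. op (u \<omega>) (v \<omega>) = op (f \<omega>) (g \<omega>)"
      using u(2) v(2) by eventually_elim simp
    then show ?thesis
      using u v f g op by (simp add: L0_class_eq_iff)
  qed
  then show ?thesis
    using L0_class_refl[OF f] L0_class_refl[OF g] unfolding L0_lift2_def by blast
qed

lemma L0_add_class:
  "f \<in> borel_measurable P \<Longrightarrow> g \<in> borel_measurable P \<Longrightarrow>
    L0_class P f \<oplus>\<^bsub>L0 P\<^esub> L0_class P g = L0_class P (\<lambda>\<omega>. f \<omega> + g \<omega>)"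
  by (simp add: L0_def L0_lift2_class)

lemma L0_mult_class:
  "f \<in> borel_measurable P \<Longrightarrow> g \<in> borel_measurable P \<Longrightarrow>
    L0_class P f \<otimes>\<^bsub>L0 P\<^esub> L0_class P g = L0_class P (\<lambda>\<omega>. f \<omega> * g \<omega>)"
  by (simp add: L0_def L0_lift2_class)

lemma L0_zero: "\<zero>\<^bsub>L0 P\<^esub> = L0_class P (\<lambda>_. 0)"
  by (simp add: L0_def)

lemma L0_one: "\<one>\<^bsub>L0 P\<^esub> = L0_class P (\<lambda>_. 1)"
  by (simp add: L0_def)

lemma L0_abs_class:
  assumes f: "f \<in> borel_measurable P"
  shows "L0_abs P (L0_class P f) = L0_class P (\<lambda>\<omega>. \<bar>f \<omega>\<bar>)"
proof -
  have "L0_class P (\<lambda>\<omega>. \<bar>u \<omega>\<bar>) = L0_class P (\<lambda>\<omega>. \<bar>f \<omega>\<bar>)" if "u \<in> L0_class P f" for u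
  proof -
    have u: "u \<in> borel_measurable P" "AE \<omega> in P. f \<omega> = u \<omega>"
      using that f by (auto simp: mem_L0_class)
    from u(2) have "AE \<omega> in P. \<bar>u \<omega>\<bar> = \<bar>f \<omega>\<bar>"
      by eventually_elim simp
    then show ?thesis
      using u f by (simp add: L0_class_eq_iff)
  qed
  then show ?thesis
    using L0_class_refl[OF f] unfolding L0_abs_def by blast
qed

lemma L0_le_class:
  assumes f: "f \<in> borel_measurable P" and g: "g \<in> borel_measurable P"
  shows "L0_le P (L0_class P f) (L0_class P g) \<longleftrightarrow> (AE \<omega> in P. f \<omega> \<le> g \<omega>)"
proof
  assume le: "AE \<omega> in P. f \<omega> \<le> g \<omega>"
  show "L0_le P (L0_class P f) (L0_class P g)"
    unfolding L0_le_def
  proof (intro ballI)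
    fix u v assume "u \<in> L0_class P f" "v \<in> L0_class P g"
    then have "AE \<omega> in P. f \<omega> = u \<omega>" "AE \<omega> in P. g \<omega> = v \<omega>"
      using f g by (auto simp: mem_L0_class)
    with le show "AE \<omega> in P. u \<omega> \<le> v \<omega>"
      by eventually_elim simp
  qed
qed (use f g in \<open>auto simp: L0_le_def L0_class_refl\<close>)

lemma L0_less_on_class:
  assumes f: "f \<in> borel_measurable P" and g: "g \<in> borel_measurable P"
  shows "L0_less_on P (L0_class P f) (L0_class P g) \<longleftrightarrow> (AE \<omega> in P. f \<omega> < g \<omega>)"
proof
  assume less: "AE \<omega> in P. f \<omega> < g \<omega>"
  show "L0_less_on P (L0_class P f) (L0_class P g)"
    unfolding L0_less_on_def
  proof (intro ballI)
    fix u v assume "u \<in> L0_class P f" "v \<in> L0_class P g"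
    then have "AE \<omega> in P. f \<omega> = u \<omega>" "AE \<omega> in P. g \<omega> = v \<omega>"
      using f g by (auto simp: mem_L0_class)
    with less show "AE \<omega> in P. u \<omega> < v \<omega>"
      by eventually_elim simp
  qed
qed (use f g in \<open>auto simp: L0_less_on_def L0_class_refl\<close>)

lemma cring_L0: "cring (L0 P)"
proof (rule cringI)
  show "abelian_group (L0 P)"
  proof (rule abelian_groupI)
    fix x assume "x \<in> carrier (L0 P)"
    then obtain f where f: "f \<in> borel_measurable P" "x = L0_class P f"
      by (rule L0_carrierE)
    then have "L0_class P (\<lambda>\<omega>. - f \<omega>) \<oplus>\<^bsub>L0 P\<^esub> x = \<zero>\<^bsub>L0 P\<^esub>"
      by (simp add: L0_add_class L0_zero)
    then show "\<exists>y\<in>carrier (L0 P). y \<oplus>\<^bsub>L0 P\<^esub> x = \<zero>\<^bsub>L0 P\<^esub>"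
      using f by (auto intro!: L0_class_in_carrier)
  qed (auto elim!: L0_carrierE simp: L0_add_class L0_zero algebra_simps
        intro!: L0_class_in_carrier)
  show "comm_monoid (L0 P)"
    by (rule comm_monoidI)
      (auto elim!: L0_carrierE simp: L0_mult_class L0_one algebra_simps
        intro!: L0_class_in_carrier)
qed (auto elim!: L0_carrierE simp: L0_mult_class L0_add_class algebra_simps)

lemma L0_minus_class:
  assumes f: "f \<in> borel_measurable P" and g: "g \<in> borel_measurable P"
  shows "L0_class P f \<ominus>\<^bsub>L0 P\<^esub> L0_class P g = L0_class P (\<lambda>\<omega>. f \<omega> - g \<omega>)"
proof -
  interpret cring "L0 P" by (rule cring_L0)
  have "\<ominus>\<^bsub>L0 P\<^esub> L0_class P g = L0_class P (\<lambda>\<omega>. - g \<omega>)"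
    by (rule minus_equality)
      (use g in \<open>simp_all add: L0_add_class L0_zero L0_class_in_carrier\<close>)
  then show ?thesis
    using f g by (simp add: a_minus_def L0_add_class)
qed

lemma openin_L0_topology:
  "openin (L0_topology P) G \<longleftrightarrow> G \<subseteq> carrier (L0 P) \<and>
     (\<forall>x\<in>G. \<exists>\<epsilon>\<in>L0_pplus P.
        {y \<in> carrier (L0 P). L0_le P (L0_abs P (y \<ominus>\<^bsub>L0 P\<^esub> x)) \<epsilon>} \<subseteq> G)"
proof -
  let ?ball = "\<lambda>x \<epsilon>. {y \<in> carrier (L0 P). L0_le P (L0_abs P (y \<ominus>\<^bsub>L0 P\<^esub> x)) \<epsilon>}"
  have smaller: "\<exists>\<epsilon>\<in>L0_pplus P. ?ball x \<epsilon> \<subseteq> ?ball x d \<inter> ?ball x e"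
    if x: "x \<in> carrier (L0 P)" and d: "d \<in> L0_pplus P" and e: "e \<in> L0_pplus P" for x d e
  proof -
    obtain f where f: "f \<in> borel_measurable P" "x = L0_class P f"
      using x by (rule L0_carrierE)
    obtain a where a: "a \<in> borel_measurable P" "d = L0_class P a"
      using d by (auto simp: L0_pplus_def elim: L0_carrierE)
    obtain b where b: "b \<in> borel_measurable P" "e = L0_class P b"
      using e by (auto simp: L0_pplus_def elim: L0_carrierE)
    define m where "m = (\<lambda>\<omega>. min (a \<omega>) (b \<omega>))"
    have m: "m \<in> borel_measurable P"
      using a b by (simp add: m_def)
    have "AE \<omega> in P. 0 < a \<omega>" "AE \<omega> in P. 0 < b \<omega>"
      using a b d e by (auto simp: L0_pplus_def L0_zero L0_less_on_class)
    then have "AE \<omega> in P. 0 < m \<omega>"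
      by eventually_elim (simp add: m_def)
    then have "L0_class P m \<in> L0_pplus P"
      using m by (simp add: L0_pplus_def L0_zero L0_less_on_class L0_class_in_carrier)
    moreover have "?ball x (L0_class P m) \<subseteq> ?ball x d \<inter> ?ball x e"
      using f a b m
      by (auto elim!: L0_carrierE simp: L0_minus_class L0_abs_class L0_le_class m_def
          intro!: L0_class_in_carrier elim: eventually_mono)
    ultimately show ?thesis by blast
  qed
  have "istopology (\<lambda>G. G \<subseteq> carrier (L0 P) \<and> (\<forall>x\<in>G. \<exists>\<epsilon>\<in>L0_pplus P. ?ball x \<epsilon> \<subseteq> G))"
    unfolding istopology_def
  proof (intro conjI allI impI ballI)
    fix S T x
    assume S: "S \<subseteq> carrier (L0 P) \<and> (\<forall>x\<in>S. \<exists>\<epsilon>\<in>L0_pplus P. ?ball x \<epsilon> \<subseteq> S)"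
      and T: "T \<subseteq> carrier (L0 P) \<and> (\<forall>x\<in>T. \<exists>\<epsilon>\<in>L0_pplus P. ?ball x \<epsilon> \<subseteq> T)"
      and x: "x \<in> S \<inter> T"
    obtain d where d: "d \<in> L0_pplus P" "?ball x d \<subseteq> S"
      using S x by blast
    obtain e where e: "e \<in> L0_pplus P" "?ball x e \<subseteq> T"
      using T x by blast
    have "x \<in> carrier (L0 P)"
      using S x by blast
    from smaller[OF this d(1) e(1)] d(2) e(2)
    show "\<exists>\<epsilon>\<in>L0_pplus P. ?ball x \<epsilon> \<subseteq> S \<inter> T"
      by (meson Int_mono order_trans)
  next
    fix K x
    assume K: "\<forall>G\<in>K. G \<subseteq> carrier (L0 P) \<and> (\<forall>x\<in>G. \<exists>\<epsilon>\<in>L0_pplus P. ?ball x \<epsilon> \<subseteq> G)"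
      and x: "x \<in> \<Union>K"
    then obtain G where "G \<in> K" "x \<in> G" by blast
    with K obtain \<epsilon> where "\<epsilon> \<in> L0_pplus P" "?ball x \<epsilon> \<subseteq> G" by blast
    with \<open>G \<in> K\<close> show "\<exists>\<epsilon>\<in>L0_pplus P. ?ball x \<epsilon> \<subseteq> \<Union>K" by blast
  qed blast+
  then show ?thesis
    by (simp add: L0_topology_def topology_inverse')
qed

lemma topspace_L0_topology: "topspace (L0_topology P) = carrier (L0 P)"
proof -
  have "L0_class P (\<lambda>_. 1) \<in> L0_pplus P"
    by (simp add: L0_pplus_def L0_zero L0_less_on_class L0_class_in_carrier)
  then have "openin (L0_topology P) (carrier (L0 P))"
    by (auto simp: openin_L0_topology)
  then show ?thesis
    by (meson openin_L0_topology openin_subset openin_topspace subset_antisym)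
qed

end

(* Every neighborhood of 0 contains an order interval of radius e, where e > 0 almost surely.
   Then e is bounded below by some constant c > 0 on a set A of positive measure, so c 1_A belongs
   to the neighborhood and agrees on A with the constant c, which belongs to M. *)
theory Submission
  imports Defs
begin

text \<open>If every set where \<open>c \<le> f\<close> with \<open>c > 0\<close> were null, then
  letting \<open>c\<close> run through the countably many values \<open>1 / Suc n\<close> would give
  \<open>f \<le> 0\<close> almost surely, against \<open>pos\<close>.\<close>

lemma (in prob_space) AE_pos_bounded_below_on_set:
  fixes f :: "'a \<Rightarrow> real"
  assumes f [measurable]: "f \<in> borel_measurable M" and pos: "AE \<omega> in M. 0 < f \<omega>"
  obtains c where "c > 0" "measure M {\<omega> \<in> space M. c \<le> f \<omega>} > 0"
proof (rule ccontr)
  assume "\<not> thesis"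
  with that have null: "c > 0 \<Longrightarrow> measure M {\<omega> \<in> space M. c \<le> f \<omega>} = 0" for c
    by (metis zero_less_measure_iff)
  have "AE \<omega> in M. f \<omega> < 1 / real (Suc n)" for n
    using null[of "1 / real (Suc n)"]
    by (subst AE_iff_measurable[OF _ refl]) (auto simp: not_less emeasure_eq_measure)
  then have "AE \<omega> in M. \<forall>n. f \<omega> < 1 / real (Suc n)"
    by (simp add: AE_all_countable)
  with pos have "AE \<omega> in M. False"
  proof eventually_elim
    case (elim \<omega>)
    obtain n where "inverse (real (Suc n)) < f \<omega>"
      using reals_Archimedean[OF elim(1)] by blast
    moreover have "f \<omega> < 1 / real (Suc n)"
      using elim(2) by blast
    ultimately show False
      by (simp add: inverse_eq_divide)
  qed
  \<comment> \<open>A property that never holds cannot hold almost surely, since the whole space has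
    mass 1.\<close>
  then show False
    by simp
qed

text \<open>The open set around zero inside \<open>U\<close> contains a ball around zero, by the
  definition of the topology. Passing from the radius \<open>\<epsilon>\<close> to a representative
  \<open>e\<close> allows membership in \<open>U\<close> to be checked by a pointwise
  estimate.\<close>

lemma nbhd_zero_contains_interval:
  assumes "nbhd_of (L0_topology P) \<zero>\<^bsub>L0 P\<^esub> U"
  obtains e where "e \<in> borel_measurable P" "AE \<omega> in P. 0 < e \<omega>"
    "\<And>f. f \<in> borel_measurable P \<Longrightarrow> AE \<omega> in P. \<bar>f \<omega>\<bar> \<le> e \<omega> \<Longrightarrow> L0_class P f \<in> U"
proof -
  obtain \<epsilon> where \<epsilon>: "\<epsilon> \<in> L0_pplus P"
    "{y \<in> carrier (L0 P). L0_le P (L0_abs P (y \<ominus>\<^bsub>L0 P\<^esub> \<zero>\<^bsub>L0 P\<^esub>)) \<epsilon>} \<subseteq> U"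
    using assms unfolding nbhd_of_def openin_L0_topology by (meson subset_trans)
  obtain e where e: "e \<in> borel_measurable P" "\<epsilon> = L0_class P e"
    using \<epsilon>(1) by (auto simp: L0_pplus_def elim: L0_carrierE)
  show thesis
  proof
    show "AE \<omega> in P. 0 < e \<omega>"
      using \<epsilon>(1) e by (simp add: L0_pplus_def L0_zero L0_less_on_class)
    show "L0_class P f \<in> U" if "f \<in> borel_measurable P" "AE \<omega> in P. \<bar>f \<omega>\<bar> \<le> e \<omega>" for f
      using \<epsilon>(2) that e
      by (auto simp: L0_zero L0_minus_class L0_abs_class L0_le_class L0_class_in_carrier)
  qed (fact e)
qed

theorem claim4p13:
  fixes P :: "'a measure" and M :: "('a \<Rightarrow> real) set set"
  assumes "prob_space P"
    and "nonatomic P"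
    and M_def: "M = {x \<in> carrier (L0 P). \<exists>m::real. m > 0 \<and> L0_less_on P (L0_const P m) x}"
  shows "(\<forall>A\<in>sets P. measure P A > 0 \<longrightarrow>
            (L0_ind P A <#\<^bsub>L0 P\<^esub> {\<zero>\<^bsub>L0 P\<^esub>}) \<inter> (L0_ind P A <#\<^bsub>L0 P\<^esub> M) = {})
       \<and> (\<forall>U. nbhd_of (L0_topology P) \<zero>\<^bsub>L0 P\<^esub> U
              \<and> L0_convex P U \<and> L0_absorbent P U \<and> L0_balanced P U \<longrightarrow>
            (\<exists>A\<in>sets P. measure P A > 0 \<and>
               (L0_ind P A <#\<^bsub>L0 P\<^esub> U) \<inter> (L0_ind P A <#\<^bsub>L0 P\<^esub> (M <+>\<^bsub>L0 P\<^esub> U)) \<noteq> {}))"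
proof (intro conjI ballI allI impI)
  interpret prob_space P by fact
  fix A assume A [measurable]: "A \<in> sets P" and pos: "measure P A > 0"
  \<comment> \<open>Both sets are images under multiplication by the indicator of \<open>A\<close>,
    so their disjointness amounts to this inequality of products.\<close>
  have "L0_ind P A \<otimes>\<^bsub>L0 P\<^esub> \<zero>\<^bsub>L0 P\<^esub> \<noteq> L0_ind P A \<otimes>\<^bsub>L0 P\<^esub> x" if xM: "x \<in> M" for x
  proof
    assume eq: "L0_ind P A \<otimes>\<^bsub>L0 P\<^esub> \<zero>\<^bsub>L0 P\<^esub> = L0_ind P A \<otimes>\<^bsub>L0 P\<^esub> x"
    obtain f where f [measurable]: "f \<in> borel_measurable P" and x: "x = L0_class P f"
      using xM by (auto simp: M_def elim: L0_carrierE)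
    obtain m where m: "m > 0" and less: "AE \<omega> in P. m < f \<omega>"
      using xM by (auto simp: M_def x L0_const_def L0_less_on_class)
    have "AE \<omega> in P. 0 = indicator A \<omega> * f \<omega>"
      using eq by (simp add: x L0_ind_def L0_zero L0_mult_class L0_class_eq_iff)
    \<comment> \<open>At almost every point of \<open>A\<close> the equation forces \<open>f\<close>
      to vanish, while \<open>f\<close> exceeds \<open>m > 0\<close>.\<close>
    with less have "AE \<omega> in P. \<omega> \<notin> A"
      by eventually_elim (use m in \<open>auto simp: indicator_def split: if_splits\<close>)
    then have "emeasure P A = 0"
      by (simp add: null_setsD1 AE_iff_null_sets[OF A])
    with pos show False
      by (simp add: measure_def)
  qed
  then show "(L0_ind P A <#\<^bsub>L0 P\<^esub> {\<zero>\<^bsub>L0 P\<^esub>}) \<inter> (L0_ind P A <#\<^bsub>L0 P\<^esub> M) = {}"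
    by (auto simp: l_coset_def)
next
  interpret prob_space P by fact
  fix U assume "nbhd_of (L0_topology P) \<zero>\<^bsub>L0 P\<^esub> U
              \<and> L0_convex P U \<and> L0_absorbent P U \<and> L0_balanced P U"
  then have "nbhd_of (L0_topology P) \<zero>\<^bsub>L0 P\<^esub> U"
    by simp
  then obtain e where e [measurable]: "e \<in> borel_measurable P" and e_pos: "AE \<omega> in P. 0 < e \<omega>"
    and U: "\<And>f. f \<in> borel_measurable P \<Longrightarrow> AE \<omega> in P. \<bar>f \<omega>\<bar> \<le> e \<omega> \<Longrightarrow> L0_class P f \<in> U"
    by (rule nbhd_zero_contains_interval) blast
  obtain c where c: "c > 0" "measure P {\<omega> \<in> space P. c \<le> e \<omega>} > 0"
    using AE_pos_bounded_below_on_set[OF e e_pos] .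
  define A where "A = {\<omega> \<in> space P. c \<le> e \<omega>}"
  have A [measurable]: "A \<in> sets P"
    unfolding A_def by measurable
  \<comment> \<open>Cutting the constant \<open>c\<close> off outside \<open>A\<close> keeps it
    below \<open>e\<close>: on \<open>A\<close> by the choice of \<open>A\<close>, elsewhere because
    \<open>e\<close> is positive almost surely.\<close>
  define u where "u = L0_class P (\<lambda>\<omega>. c * indicator A \<omega>)"
  have u: "u \<in> U"
    unfolding u_def
  proof (rule U)
    show "AE \<omega> in P. \<bar>c * indicator A \<omega>\<bar> \<le> e \<omega>"
      using e_pos by eventually_elim (use c in \<open>auto simp: A_def indicator_def\<close>)
  qed simp
  have zero: "\<zero>\<^bsub>L0 P\<^esub> \<in> U"
    unfolding L0_zero by (rule U) (use e_pos in \<open>auto elim: eventually_mono\<close>)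
  \<comment> \<open>The bound in \<open>M\<close> is strict, so \<open>c\<close> cannot serve as its
    own lower bound; density yields a constant strictly between 0 and \<open>c\<close>.\<close>
  have "L0_const P c \<in> M"
    using c(1) dense[of 0 c]
    by (auto simp: M_def L0_const_def L0_less_on_class L0_class_in_carrier)
  with zero have sum: "L0_const P c \<oplus>\<^bsub>L0 P\<^esub> \<zero>\<^bsub>L0 P\<^esub> \<in> M <+>\<^bsub>L0 P\<^esub> U"
    by (auto simp: set_add_def set_mult_def)
  \<comment> \<open>Both sides are the class of \<open>c\<close> times the indicator of
    \<open>A\<close>, because an indicator is idempotent. The summand from \<open>U\<close> is
    zero.\<close>
  have "L0_ind P A \<otimes>\<^bsub>L0 P\<^esub> u = L0_ind P A \<otimes>\<^bsub>L0 P\<^esub> (L0_const P c \<oplus>\<^bsub>L0 P\<^esub> \<zero>\<^bsub>L0 P\<^esub>)"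
    by (auto simp: u_def L0_ind_def L0_const_def L0_zero L0_add_class L0_mult_class
        L0_class_eq_iff indicator_def)
  with u sum have "(L0_ind P A <#\<^bsub>L0 P\<^esub> U) \<inter> (L0_ind P A <#\<^bsub>L0 P\<^esub> (M <+>\<^bsub>L0 P\<^esub> U)) \<noteq> {}"
    unfolding l_coset_def by blast
  with A c(2) show "\<exists>A\<in>sets P. measure P A > 0 \<and>
      (L0_ind P A <#\<^bsub>L0 P\<^esub> U) \<inter> (L0_ind P A <#\<^bsub>L0 P\<^esub> (M <+>\<^bsub>L0 P\<^esub> U)) \<noteq> {}"
    unfolding A_def by blast
qed

end
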